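(* Let $c\in\mathbb{R}$ and let $n>0$ be a real number such that $n>c$ if $c\ge 0$, and $n=-cl$ for some $l\in\mathbb{N}$ if $c<0$. Let $S_{n,c}(x)=\sum_{k=0}^\infty \left(p_{n,k}^{[c]}(x)\right)^2$ for $x\in I_c$. (i) The function $y=S_{n,c}$ is a solution to the differential equation $$x(1+cx)(1+2cx)y''(x)+\bigl(4(n+c)x(1+cx)+1\bigr)y'(x)+2n(1+2cx)y(x)=0,\quad x\in I_c.$$ (ii) If $c\ne0$, let $H_{n,c}(x):=S_{n,c}\left(-\frac xc\right)$, defined on $(-\infty,0]$ if $c>0$ and on $[0,1]$ if $c<0$. Then $y=H_{n,c}$ is a solution to the Heun equation $$y''(x)+\left(\frac1x+\frac1{x-1}+\frac{\frac{2n}{c}}{x-\frac12}\right)y'(x)+\frac{\frac{2n}{c}x-\frac nc}{x(x-1)\left(x-\frac12\right)}y(x)=0$$ at all points of its domain with $x\notin\{0,\frac12,1\}$; that is, the Heun equation with singular point $a=\frac12$ and parameters $\alpha=1$, $\beta=\frac{2n}{c}$, $\gamma=1$, $\delta=1$, $\epsilon=\frac{2n}{c}$, $q=\frac nc$.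
   Context: For $c\in\mathbb{R}$ the interval $I_c$ is $I_c=\left[0,-\frac1c\right]$ if $c<0$ and $I_c=[0,+\infty)$ if $c\ge 0$. For $\alpha\in\mathbb{R}$, $\binom{\alpha}{0}=1$ and $\binom{\alpha}{k}=\frac{\alpha(\alpha-1)\cdots(\alpha-k+1)}{k!}$ for $k\in\mathbb{N}=\{1,2,\dots\}$. For $k\in\mathbb{N}_0=\{0,1,2,\dots\}$ and $x\in I_c$, $$p_{n,k}^{[c]}(x)=(-1)^k\binom{-\frac nc}{k}(cx)^k(1+cx)^{-\frac nc-k}\quad (c\ne 0),\qquad p_{n,k}^{[0]}(x)=\frac{(nx)^k}{k!}e^{-nx}.$$ When $c<0$ and $n=-cl$, one has $-\frac nc=l$, so $p_{n,k}^{[c]}$ is identically $0$ for $k>l$ and is a polynomial for $k\le l$ (with the convention $0^0=1$). Derivatives at endpoints of $I_c$ are one-sided. The Heun equation with singular points $0,1,a$ and parameters $\alpha,\beta,\gamma,\delta,\epsilon,q$ (with $\gamma+\delta+\epsilon=\alpha+\beta+1$) is $$y''+\left(\frac{\gamma}{x}+\frac{\delta}{x-1}+\frac{\epsilon}{x-a}\right)y'+\frac{\alpha\beta x-q}{x(x-1)(x-a)}y=0.$$ *)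

theory Defs
  imports "HOL-Analysis.Analysis"
begin

definition dom_S :: "real \<Rightarrow> real set" where
  "dom_S c = (if c < 0 then {0 .. -1 / c} else {0 ..})"

text \<open>Real power with the convention \<open>0\<^sup>0 = 1\<close>, whereas \<open>0 powr 0 = 0\<close>. The only case in which
  this matters below is \<open>c < 0\<close>, \<open>n = -c l\<close>, \<open>k = l\<close> at the right endpoint \<open>x = -1/c\<close>, where
  the factor \<open>(1 + c x)\<close> vanishes and the exponent \<open>-n/c - k\<close> is \<open>0\<close>.\<close>
definition rpow :: "real \<Rightarrow> real \<Rightarrow> real" where
  "rpow b e = (if e = 0 then 1 else b powr e)"

definition p_basis :: "real \<Rightarrow> real \<Rightarrow> nat \<Rightarrow> real \<Rightarrow> real" where
  "p_basis c n k x =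
     (if c = 0 then (n * x) ^ k / fact k * exp (- (n * x))
      else (-1) ^ k * ((- n / c) gchoose k) * (c * x) ^ k * rpow (1 + c * x) (- n / c - real k))"

definition S_sum :: "real \<Rightarrow> real \<Rightarrow> real \<Rightarrow> real" where
  "S_sum n c x = (\<Sum>k. (p_basis c n k x)\<^sup>2)"

text \<open>A second-order equation is given as a relation \<open>E x (y x) (y' x) (y'' x)\<close>. Taking derivatives
  within \<open>D\<close> makes them one-sided at endpoints of an interval \<open>D\<close> and two-sided at
  interior points.\<close>
definition solution_on ::
  "(real \<Rightarrow> real \<Rightarrow> real \<Rightarrow> real \<Rightarrow> bool) \<Rightarrow> real set \<Rightarrow> (real \<Rightarrow> real) \<Rightarrow> bool" where
  "solution_on E D y \<longleftrightarrow>
     (\<exists>y' y''. \<forall>x\<in>D. (y has_real_derivative y' x) (at x within D) \<and>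
                     (y' has_real_derivative y'' x) (at x within D) \<and>
                     E x (y x) (y' x) (y'' x))"

definition heun_equation ::
  "real \<Rightarrow> real \<Rightarrow> real \<Rightarrow> real \<Rightarrow> real \<Rightarrow> real \<Rightarrow> real \<Rightarrow> real \<Rightarrow> real \<Rightarrow> real \<Rightarrow> real \<Rightarrow> bool" where
  "heun_equation a \<alpha> \<beta> \<gamma> \<delta> \<epsilon> q x y y' y'' \<longleftrightarrow>
     \<gamma> + \<delta> + \<epsilon> = \<alpha> + \<beta> + 1 \<and>
     y'' + (\<gamma> / x + \<delta> / (x - 1) + \<epsilon> / (x - a)) * y'
         + (\<alpha> * \<beta> * x - q) / (x * (x - 1) * (x - a)) * y = 0"

definition H_sum :: "real \<Rightarrow> real \<Rightarrow> real \<Rightarrow> real" where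
  "H_sum n c x = S_sum n c (- x / c)"

text \<open>Only used for \<open>c \<noteq> 0\<close>.\<close>
definition dom_H :: "real \<Rightarrow> real set" where
  "dom_H c = (if c > 0 then {..0} else {0..1})"

text \<open>The series defining \<open>S_sum\<close> converges on \<open>dom_S c\<close> under the standing assumptions on \<open>n\<close> and \<open>c\<close>, so
  \<open>S_sum\<close> is the genuine sum there.\<close>

lemma summable_square:
  fixes f :: "nat \<Rightarrow> real"
  assumes "summable (\<lambda>k. norm (f k))"
  shows "summable (\<lambda>k. (f k)\<^sup>2)"
proof (rule summable_comparison_test_ev[OF _ assms])
  have "(\<lambda>k. norm (f k)) \<longlonglongrightarrow> 0" using assms by (rule summable_LIMSEQ_zero)
  hence "eventually (\<lambda>k. norm (f k) < 1) sequentially"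
    by (rule order_tendstoD) simp
  thus "eventually (\<lambda>k. norm ((f k)\<^sup>2) \<le> norm (f k)) sequentially"
  proof eventually_elim
    case (elim k)
    have "\<bar>f k\<bar> * \<bar>f k\<bar> \<le> 1 * \<bar>f k\<bar>" using elim by (intro mult_right_mono) auto
    thus ?case by (simp add: power2_eq_square abs_mult)
  qed
qed

lemma summable_p_squared:
  fixes c n x :: real
  assumes "c < 0 \<Longrightarrow> \<exists>l::nat. l \<ge> 1 \<and> n = - c * real l" and x: "x \<in> dom_S c"
  shows "summable (\<lambda>k. (p_basis c n k x)\<^sup>2)"
proof -
  consider "c < 0" | "c = 0" | "c > 0" by linarith
  thus ?thesis
  proof cases
    case 1
    with assms(1) obtain l :: nat where l: "n = - c * real l" by blast
    with 1 have eq: "- n / c = real l" by (simp add: field_simps)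
    have "p_basis c n k x = 0" if "k > l" for k
      using 1 that unfolding p_basis_def eq binomial_gbinomial[symmetric] by (simp add: binomial_eq_0)
    hence "(p_basis c n k x)\<^sup>2 = 0" if "k \<notin> {..l}" for k using that by simp
    thus ?thesis by (intro summable_finite[of "{..l}"]) auto
  next
    case 2
    have "summable (\<lambda>k. norm (inverse (fact k) * (n * x) ^ k) * exp (- (n * x)))"
      using summable_norm_exp[of "n * x"] by (intro summable_mult2) simp
    moreover have "norm (inverse (fact k) * (n * x) ^ k) * exp (- (n * x)) = norm (p_basis c n k x)" for k
      using 2 by (simp add: p_basis_def abs_mult divide_inverse)
    ultimately show ?thesis by (intro summable_square) simp
  next
    case 3
    define m where "m = - n / c"
    define z where "z = - (c * x) / (1 + c * x)"
    define w where "w = (1 + \<bar>z\<bar>) / 2"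
    from x 3 have cx: "c * x \<ge> 0" by (simp add: dom_S_def)
    hence z: "\<bar>z\<bar> < 1" by (simp add: z_def)
    hence w: "\<bar>w\<bar> < 1" "\<bar>z\<bar> < \<bar>w\<bar>" by (auto simp: w_def)
    have "summable (\<lambda>k. (m gchoose k) * w ^ k)"
      using gen_binomial_real[OF w(1)] sums_summable by blast
    hence "summable (\<lambda>k. norm ((m gchoose k) * z ^ k))"
      using w(2) by (intro powser_insidea[of _ w]) auto
    hence "summable (\<lambda>k. norm ((m gchoose k) * z ^ k) * (1 + c * x) powr m)"
      by (rule summable_mult2)
    moreover have "norm ((m gchoose k) * z ^ k) * (1 + c * x) powr m = norm (p_basis c n k x)" for k
    proof -
      have "rpow (1 + c * x) (m - real k) = (1 + c * x) powr m / (1 + c * x) ^ k"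
        using cx by (auto simp: rpow_def powr_diff powr_realpow)
      hence "p_basis c n k x = (-1) ^ k * (m gchoose k) * (c * x) ^ k
               * ((1 + c * x) powr m / (1 + c * x) ^ k)"
        using 3 by (simp only: p_basis_def m_def[symmetric]) simp
      thus ?thesis
        using cx by (simp add: z_def abs_mult power_abs power_divide)
    qed
    ultimately show ?thesis by (intro summable_square) simp
  qed
qed

end

theory Submission
  imports Defs
begin

text \<open>
  With \<open>A\<^sub>k = n (n + c) \<dots> (n + (k - 1) c) / k!\<close> and the weight \<open>w\<close> solving \<open>w' = - n w / (1 + c x)\<close>, one has
  \<open>p\<^sub>k(x) = A\<^sub>k w(x) (x / (1 + c x))\<^sup>k\<close> for all real \<open>c\<close>, wherever \<open>1 + c x > 0\<close>. Hence
  \<open>S = w\<^sup>2 F(z)\<close> with \<open>z = (x / (1 + c x))\<^sup>2\<close> and \<open>F(z) = \<Sum>k. A\<^sub>k\<^sup>2 z\<^sup>k\<close>. The recurrence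
  \<open>(k + 1)\<^sup>2 A\<^sub>k\<^sub>+\<^sub>1\<^sup>2 = (n + k c)\<^sup>2 A\<^sub>k\<^sup>2\<close> is a hypergeometric-type equation for \<open>F\<close>, which transforms into the
  equation for \<open>S\<close>. The only point missed is \<open>x = -1/c\<close> for \<open>c < 0\<close>; there \<open>S\<close> is a polynomial and the
  equation extends by continuity. The Heun equation is the substitution \<open>x \<mapsto> - x / c\<close>.
\<close>

section \<open>Factorization of the basis functions, uniformly in c\<close>

definition weight :: "real \<Rightarrow> real \<Rightarrow> real \<Rightarrow> real" where
  "weight n c x = (if c = 0 then exp (- (n * x)) else (1 + c * x) powr (- n / c))"

text \<open>For c \<noteq> 0 this is \<open>(-1) ^ k * ((- n / c) gchoose k) * c ^ k\<close> with
  one c absorbed into each factor: -(-n/c - i) c = n + i c. The form is free of division by c and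
  gives n^k / k! at c = 0.\<close>

definition basis_coeff :: "real \<Rightarrow> real \<Rightarrow> nat \<Rightarrow> real" where
  "basis_coeff n c k = (\<Prod>i<k. n + real i * c) / fact k"

lemma basis_coeff_gchoose:
  assumes "c \<noteq> 0"
  shows "basis_coeff n c k = (-1) ^ k * ((- n / c) gchoose k) * c ^ k"
proof -
  have "(\<Prod>i<k. n + real i * c) = (\<Prod>i<k. (-1) * (- n / c - real i) * c)"
    using assms by (intro prod.cong) (auto simp: field_simps)
  also have "\<dots> = (-1) ^ k * (\<Prod>i<k. - n / c - real i) * c ^ k"
    unfolding prod.distrib by simp
  finally show ?thesis
    by (simp add: basis_coeff_def gbinomial_prod_rev atLeast0LessThan)
qed

lemma basis_coeff_Suc: "real (Suc k) * basis_coeff n c (Suc k) = (n + real k * c) * basis_coeff n c k"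
  by (simp add: basis_coeff_def field_simps del: of_nat_Suc)

lemma p_basis_eq:
  assumes "1 + c * x > 0"
  shows "p_basis c n k x = basis_coeff n c k * weight n c x * (x / (1 + c * x)) ^ k"
proof (cases "c = 0")
  case True
  then show ?thesis
    by (simp add: p_basis_def basis_coeff_def weight_def power_mult_distrib)
next
  case False
  have "rpow (1 + c * x) (- n / c - real k) = (1 + c * x) powr (- n / c) / (1 + c * x) ^ k"
    using assms by (auto simp: rpow_def powr_diff powr_realpow)
  then show ?thesis
    using False by (simp add: p_basis_def basis_coeff_gchoose weight_def power_mult_distrib power_divide)
qed

lemma weight_pos: "1 + c * x > 0 \<Longrightarrow> weight n c x > 0"
  by (simp add: weight_def)

lemma DERIV_weight:
  assumes "1 + c * x > 0"
  shows "(weight n c has_real_derivative (- n * weight n c x / (1 + c * x))) (at x)"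
proof (cases "c = 0")
  case True
  have "weight n c = (\<lambda>x. exp (- (n * x)))" using True by (auto simp: weight_def)
  then show ?thesis using True by (auto intro!: derivative_eq_intros)
next
  case False
  have "weight n c = (\<lambda>x. (1 + c * x) powr (- n / c))" using False by (auto simp: weight_def)
  moreover have "((\<lambda>x. (1 + c * x) powr (- n / c)) has_real_derivative
      (- n / c) * (1 + c * x) powr (- n / c - 1) * c) (at x)"
    using assms by (auto intro!: derivative_eq_intros)
  ultimately show ?thesis using False assms by (simp add: powr_diff)
qed

section \<open>The differential equation of the power series F\<close>

text \<open>Multiply the recurrence by z^k and sum over k. The left side gives z F'' + F', the right
  side n^2 F + 2 n c z F' + c^2 z (z F'' + F'). Convergence at a single \<open>K\<close> of larger
  modulus than z justifies termwise differentiation at z.\<close>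

lemma powser_derivs_ode:
  fixes a :: "nat \<Rightarrow> real" and K z n c :: real
  defines "F \<equiv> (\<lambda>b z. \<Sum>k. b k * z ^ k)"
  assumes rec: "\<And>k. (real (Suc k))\<^sup>2 * a (Suc k) = (n + real k * c)\<^sup>2 * a k"
    and sm: "summable (\<lambda>k. a k * K ^ k)" and z: "\<bar>z\<bar> < \<bar>K\<bar>"
  shows "DERIV (F a) z :> F (diffs a) z" "DERIV (F (diffs a)) z :> F (diffs (diffs a)) z"
    "(1 - c\<^sup>2 * z) * (z * F (diffs (diffs a)) z + F (diffs a) z)
       = n\<^sup>2 * F a z + 2 * n * c * z * F (diffs a) z"
proof -
  have sm_a: "summable (\<lambda>k. a k * t ^ k)" if "norm t < \<bar>K\<bar>" for t
    using that powser_inside[OF sm] by simp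
  have sm_d: "summable (\<lambda>k. diffs a k * t ^ k)" if "norm t < \<bar>K\<bar>" for t
    using that sm_a by (rule termdiff_converges)
  have sm_dd: "summable (\<lambda>k. diffs (diffs a) k * t ^ k)" if "norm t < \<bar>K\<bar>" for t
    using that sm_d by (rule termdiff_converges)
  \<comment> \<open>The differentiated series may diverge at \<open>K\<close> itself, so its own
    termwise differentiation uses a radius strictly in between.\<close>
  obtain L where L: "\<bar>z\<bar> < L" "L < \<bar>K\<bar>" using dense[OF z] by blast
  show "DERIV (F a) z :> F (diffs a) z"
    unfolding F_def using sm z by (intro termdiffs_strong) auto
  show "DERIV (F (diffs a)) z :> F (diffs (diffs a)) z"
    unfolding F_def using L sm_d[of L] by (intro termdiffs_strong[of _ L]) auto
  define F0 F1 F2 where "F0 = F a z" and "F1 = F (diffs a) z" and "F2 = F (diffs (diffs a)) z"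
  have s0: "(\<lambda>k. a k * z ^ k) sums F0"
    unfolding F0_def F_def using z by (intro summable_sums sm_a) simp
  have s1: "(\<lambda>k. diffs a k * z ^ k) sums F1"
    unfolding F1_def F_def using z by (intro summable_sums sm_d) simp
  \<comment> \<open>At k = 0 the truncated exponent would produce a spurious z, but the factor
    \<open>real k\<close> is 0.\<close>
  have shift: "real k * b * z ^ (k - Suc 0) * z = real k * b * z ^ k" for k b
    by (cases k) auto
  have "(\<lambda>k. real k * a k * z ^ (k - Suc 0) * z) sums (F1 * z)"
    unfolding F1_def F_def using z by (intro sums_mult2 diffs_equiv sm_d) simp
  then have s1z: "(\<lambda>k. real k * a k * z ^ k) sums (F1 * z)"
    unfolding shift .
  have "(\<lambda>k. real k * diffs a k * z ^ (k - Suc 0) * z) sums (F2 * z)"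
    unfolding F2_def F_def using z by (intro sums_mult2 diffs_equiv sm_dd) simp
  then have "(\<lambda>k. real k * diffs a k * z ^ k) sums (F2 * z)"
    unfolding shift .
  from sums_add[OF this s1]
  \<comment> \<open>k (k + 1) a_{k+1} + (k + 1) a_{k+1} = (k + 1)^2 a_{k+1}.\<close>
  have s2: "(\<lambda>k. (real (Suc k))\<^sup>2 * a (Suc k) * z ^ k) sums (F2 * z + F1)"
    by (simp add: diffs_def algebra_simps power2_eq_square)
  have "(\<lambda>k. (real (Suc k))\<^sup>2 * a (Suc k) * z ^ Suc k) sums ((F2 * z + F1) * z)"
    using sums_mult2[OF s2, of z] by (simp add: mult_ac)
  \<comment> \<open>The index shift adds only the term k = 0, which vanishes.\<close>
  then have "(\<lambda>k. (real k)\<^sup>2 * a k * z ^ k) sums ((F2 * z + F1) * z)"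
    using sums_Suc_iff[of "\<lambda>k. (real k)\<^sup>2 * a k * z ^ k"] by simp
  from sums_add[OF sums_add[OF sums_mult[OF s0, of "n\<^sup>2"] sums_mult[OF s1z, of "2 * n * c"]]
      sums_mult[OF this, of "c\<^sup>2"]]
  have "(\<lambda>k. (n + real k * c)\<^sup>2 * a k * z ^ k) sums
      (n\<^sup>2 * F0 + 2 * n * c * (F1 * z) + c\<^sup>2 * ((F2 * z + F1) * z))"
    by (simp add: algebra_simps power2_eq_square)
  then have "F2 * z + F1 = n\<^sup>2 * F0 + 2 * n * c * (F1 * z) + c\<^sup>2 * ((F2 * z + F1) * z)"
    using s2 unfolding rec by (rule sums_unique2[rotated])
  then show "(1 - c\<^sup>2 * z) * (z * F (diffs (diffs a)) z + F (diffs a) z)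
       = n\<^sup>2 * F a z + 2 * n * c * z * F (diffs a) z"
    unfolding F0_def[symmetric] F1_def[symmetric] F2_def[symmetric] by algebra
qed

section \<open>The equation for S where 1 + c x > 0\<close>

text \<open>Derivatives within \<open>D\<close> see only values on \<open>D\<close>, so a closed
  form \<open>g\<close> valid just there may replace \<open>y\<close>.\<close>

lemma solution_onI_ext:
  assumes "\<And>x. x \<in> D \<Longrightarrow> y x = g x"
    and "\<And>x. x \<in> D \<Longrightarrow> (g has_real_derivative g' x) (at x within D)"
    and "\<And>x. x \<in> D \<Longrightarrow> (g' has_real_derivative g'' x) (at x within D)"
    and "\<And>x. x \<in> D \<Longrightarrow> E x (g x) (g' x) (g'' x)"
  shows "solution_on E D y"
  unfolding solution_on_def
proof (rule exI[of _ g'], rule exI[of _ g''], intro ballI conjI)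
  fix x assume x: "x \<in> D"
  show "(y has_real_derivative g' x) (at x within D)"
    using assms(2)[OF x] by (rule has_field_derivative_transform_within[OF _ zero_less_one x])
      (simp add: assms(1))
qed (use assms in auto)

definition S_ode :: "real \<Rightarrow> real \<Rightarrow> real \<Rightarrow> real \<Rightarrow> real \<Rightarrow> real \<Rightarrow> bool" where
  "S_ode n c x y y' y'' \<longleftrightarrow> x * (1 + c * x) * (1 + 2 * c * x) * y''
              + (4 * (n + c) * x * (1 + c * x) + 1) * y'
              + 2 * n * (1 + 2 * c * x) * y = 0"

text \<open>With r = 1 / (1 + c x), one has z' = 2 x r^3 and W' = -2 n r W for W = w^2, so the last
  two arguments of \<open>S_ode\<close> are the formal first and second derivatives of W F(z).
  Inserting them gives 4 x r W times the equation for F.\<close>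

lemma S_ode_from_powser_ode:
  fixes n c x r z F F1 F2 W :: real
  assumes u: "(1 + c * x) * r = 1" and z: "z = (x * r)\<^sup>2"
    and ode: "(1 - c\<^sup>2 * z) * (z * F2 + F1) = n\<^sup>2 * F + 2 * n * c * z * F1"
  shows "S_ode n c x (W * F) (W * (- 2 * n * r * F + 2 * x * r ^ 3 * F1))
    (W * ((4 * n\<^sup>2 + 2 * n * c) * r\<^sup>2 * F + (2 * r ^ 3 - 6 * c * x * r ^ 4 - 8 * n * x * r ^ 4) * F1
       + 4 * x\<^sup>2 * r ^ 6 * F2))"
proof -
  define A where "A = x * (1 + c * x) * (1 + 2 * c * x) * ((4 * n\<^sup>2 + 2 * n * c) * r\<^sup>2)
    + (4 * (n + c) * x * (1 + c * x) + 1) * (- 2 * n * r) + 2 * n * (1 + 2 * c * x)"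
  define B where "B = x * (1 + c * x) * (1 + 2 * c * x) * (2 * r ^ 3 - 6 * c * x * r ^ 4 - 8 * n * x * r ^ 4)
    + (4 * (n + c) * x * (1 + c * x) + 1) * (2 * x * r ^ 3)"
  define C where "C = x * (1 + c * x) * (1 + 2 * c * x) * (4 * x\<^sup>2 * r ^ 6)"
  \<comment> \<open>Since (1 + c x)^2 - (c x)^2 = 1 + 2 c x, the singularity z = 1 / c^2 of the
    series equation becomes the factor 1 + 2 c x.\<close>
  have e: "(1 + 2 * c * x) * r\<^sup>2 = 1 - c\<^sup>2 * z" unfolding z using u by algebra
  have A: "A = - 4 * x * r * n\<^sup>2" unfolding A_def using u by algebra
  have B: "B = 4 * x * r * ((1 + 2 * c * x) * r\<^sup>2 - 2 * n * c * z)" unfolding B_def z using u by algebra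
  have C: "C = 4 * x * r * ((1 + 2 * c * x) * r\<^sup>2 * z)" unfolding C_def z using u by algebra
  have "x * (1 + c * x) * (1 + 2 * c * x) * (W * ((4 * n\<^sup>2 + 2 * n * c) * r\<^sup>2 * F
       + (2 * r ^ 3 - 6 * c * x * r ^ 4 - 8 * n * x * r ^ 4) * F1 + 4 * x\<^sup>2 * r ^ 6 * F2))
     + (4 * (n + c) * x * (1 + c * x) + 1) * (W * (- 2 * n * r * F + 2 * x * r ^ 3 * F1))
     + 2 * n * (1 + 2 * c * x) * (W * F) = W * (A * F + B * F1 + C * F2)"
    unfolding A_def B_def C_def by (simp only: algebra_simps)
  also have "\<dots> = 4 * x * r * W * ((1 - c\<^sup>2 * z) * (z * F2 + F1) - (n\<^sup>2 * F + 2 * n * c * z * F1))"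
    unfolding A B C e by (simp add: algebra_simps)
  finally show ?thesis unfolding S_ode_def ode by simp
qed

lemma S_sum_solution_on_positive:
  assumes hc: "c < 0 \<Longrightarrow> \<exists>l::nat. l \<ge> 1 \<and> n = - c * real l"
    and D: "D = {x \<in> dom_S c. 1 + c * x > 0}"
  shows "solution_on (S_ode n c) D (S_sum n c)"
proof -
  define a where "a k = (basis_coeff n c k)\<^sup>2" for k
  define F where "F = (\<lambda>b z. \<Sum>k. b k * z ^ k :: real)"
  define r where "r x = 1 / (1 + c * x)" for x
  define W where "W x = (weight n c x)\<^sup>2" for x
  define Z where "Z x = (x * r x)\<^sup>2" for x
  have rec: "(real (Suc k))\<^sup>2 * a (Suc k) = (n + real k * c)\<^sup>2 * a k" for k
    unfolding a_def power_mult_distrib[symmetric] basis_coeff_Suc ..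
  have term_eq: "(p_basis c n k x)\<^sup>2 = W x * (a k * Z x ^ k)" if "1 + c * x > 0" for k x
    using that by (simp add: p_basis_eq a_def W_def Z_def r_def power_mult_distrib mult_ac
        flip: power_mult)
  \<comment> \<open>Inherited from the series of squared basis functions by cancelling the nonzero
    factor \<open>W x\<close>.\<close>
  have sm: "summable (\<lambda>k. a k * Z x ^ k)" if "x \<in> D" for x
  proof -
    have "summable (\<lambda>k. W x * (a k * Z x ^ k))"
      using summable_p_squared[OF hc, of x] that by (simp add: D term_eq)
    then show ?thesis
      using weight_pos[of c x n] that by (simp add: summable_cmult_iff D W_def)
  qed
  \<comment> \<open>This puts \<open>Z x\<close> strictly inside the disc of convergence without
    computing the radius: x / (1 + c x) is strictly increasing and \<open>D\<close> has no largest
    element.\<close>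
  have ex_greater: "\<exists>x'\<in>D. \<bar>Z x\<bar> < \<bar>Z x'\<bar>" if x: "x \<in> D" for x
  proof -
    have "\<exists>x'\<in>D. x < x'"
    proof (cases "c < 0")
      case True
      with x have "x < - 1 / c" by (simp add: D field_simps)
      then obtain y where y: "x < y" "y < - 1 / c" using dense by blast
      then have "y \<in> D" using x True by (auto simp: D dom_S_def field_simps)
      then show ?thesis using y by blast
    next
      case False
      then have "x + 1 \<in> D" using x by (auto simp: D dom_S_def intro!: add_pos_nonneg mult_nonneg_nonneg)
      then show ?thesis by (intro bexI[of _ "x + 1"]) auto
    qed
    then obtain x' where x': "x' \<in> D" "x < x'" by blast
    have pos: "1 + c * x > 0" "1 + c * x' > 0" "x \<ge> 0" using x x' by (auto simp: D dom_S_def split: if_splits)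
    then have "x * r x < x' * r x'" using x' by (simp add: r_def field_simps)
    then have "Z x < Z x'" unfolding Z_def using pos by (intro power_strict_mono) (auto simp: r_def)
    then show ?thesis using x' by (intro bexI[of _ x']) (auto simp: Z_def)
  qed
  have dF: "DERIV (F a) (Z x) :> F (diffs a) (Z x)"
      "DERIV (F (diffs a)) (Z x) :> F (diffs (diffs a)) (Z x)"
      "(1 - c\<^sup>2 * Z x) * (Z x * F (diffs (diffs a)) (Z x) + F (diffs a) (Z x))
       = n\<^sup>2 * F a (Z x) + 2 * n * c * Z x * F (diffs a) (Z x)" if x: "x \<in> D" for x
  proof -
    obtain x' where x': "x' \<in> D" "\<bar>Z x\<bar> < \<bar>Z x'\<bar>" using ex_greater[OF x] by blast
    show "DERIV (F a) (Z x) :> F (diffs a) (Z x)"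
      "DERIV (F (diffs a)) (Z x) :> F (diffs (diffs a)) (Z x)"
      "(1 - c\<^sup>2 * Z x) * (Z x * F (diffs (diffs a)) (Z x) + F (diffs a) (Z x))
       = n\<^sup>2 * F a (Z x) + 2 * n * c * Z x * F (diffs a) (Z x)"
      unfolding F_def by (fact powser_derivs_ode[OF rec sm[OF x'(1)] x'(2)])+
  qed
  have dr: "DERIV r x :> - c * (r x)\<^sup>2" if "1 + c * x > 0" for x
    unfolding r_def using that
    by (auto intro!: derivative_eq_intros simp: power2_eq_square divide_simps)
  have dW: "DERIV W x :> - 2 * n * r x * W x" if "1 + c * x > 0" for x
    unfolding W_def using that
    by (auto intro!: derivative_eq_intros DERIV_weight simp: power2_eq_square r_def)
  have ur: "(1 + c * x) * r x = 1" if "1 + c * x > 0" for x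
    using that by (simp add: r_def)
  have dZ: "DERIV Z x :> 2 * x * r x ^ 3" if "1 + c * x > 0" for x
  proof -
    have "DERIV Z x :> 2 * (x * r x) * (r x + x * (- c * (r x)\<^sup>2))"
      unfolding Z_def using that by (auto intro!: derivative_eq_intros dr)
    moreover have "2 * (x * r x) * (r x + x * (- c * (r x)\<^sup>2)) = 2 * x * r x ^ 3"
      using ur[OF that] by algebra
    ultimately show ?thesis by (rule DERIV_cong)
  qed
  show ?thesis
  proof (rule solution_onI_ext)
    fix x assume x: "x \<in> D"
    then have u: "1 + c * x > 0" by (simp add: D)
    have dr3: "DERIV (\<lambda>x. r x ^ 3) x :> - 3 * c * r x ^ 4"
      using DERIV_power[OF dr[OF u], of 3] by (simp add: algebra_simps flip: power_add)
    note dFZ = DERIV_chain2[OF dF(1)[OF x] dZ[OF u]] DERIV_chain2[OF dF(2)[OF x] dZ[OF u]]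
    show "S_sum n c x = W x * F a (Z x)"
      unfolding S_sum_def F_def term_eq[OF u] using sm[OF x] by (rule suminf_mult)
    show "((\<lambda>x. W x * F a (Z x)) has_real_derivative
        W x * (- 2 * n * r x * F a (Z x) + 2 * x * r x ^ 3 * F (diffs a) (Z x))) (at x within D)"
      \<comment> \<open>Product and chain rule give a two-sided derivative, even at x = 0, which is
        then restricted to \<open>D\<close>.\<close>
      by (rule DERIV_subset[OF _ subset_UNIV],
          (rule dFZ dW[OF u] derivative_eq_intros refl)+) algebra
    show "((\<lambda>x. W x * (- 2 * n * r x * F a (Z x) + 2 * x * r x ^ 3 * F (diffs a) (Z x)))
        has_real_derivative
        W x * ((4 * n\<^sup>2 + 2 * n * c) * (r x)\<^sup>2 * F a (Z x)
          + (2 * r x ^ 3 - 6 * c * x * r x ^ 4 - 8 * n * x * r x ^ 4) * F (diffs a) (Z x)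
          + 4 * x\<^sup>2 * r x ^ 6 * F (diffs (diffs a)) (Z x))) (at x within D)"
      by (rule DERIV_subset[OF _ subset_UNIV],
          (rule dFZ dW[OF u] dr[OF u] dr3 derivative_eq_intros refl)+) algebra
    show "S_ode n c x (W x * F a (Z x))
        (W x * (- 2 * n * r x * F a (Z x) + 2 * x * r x ^ 3 * F (diffs a) (Z x)))
        (W x * ((4 * n\<^sup>2 + 2 * n * c) * (r x)\<^sup>2 * F a (Z x)
          + (2 * r x ^ 3 - 6 * c * x * r x ^ 4 - 8 * n * x * r x ^ 4) * F (diffs a) (Z x)
          + 4 * x\<^sup>2 * r x ^ 6 * F (diffs (diffs a)) (Z x)))"
      using ur[OF u] dF(3)[OF x] by (intro S_ode_from_powser_ode) (auto simp: Z_def)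
  qed
qed

section \<open>The polynomial case c < 0 and the right endpoint\<close>

text \<open>Here -n/c = l, so the basis functions vanish for k > l and the others are A_k x^k (1 + c
  x)^(l - k), right endpoint included.\<close>

lemma S_sum_polynomial:
  assumes c: "c < 0" and n: "n = - c * real l"
  obtains P where "\<And>x. x \<in> dom_S c \<Longrightarrow> S_sum n c x = poly P x"
proof
  let ?P = "\<Sum>k\<le>l. smult ((basis_coeff n c k)\<^sup>2) ([:0, 1:] ^ (2 * k) * [:1, c:] ^ (2 * (l - k)))"
  fix x assume x: "x \<in> dom_S c"
  have eq: "- n / c = real l" using c n by simp
  have nonneg: "1 + c * x \<ge> 0" using x c by (simp add: dom_S_def field_simps)
  have p: "p_basis c n k x = basis_coeff n c k * x ^ k * (1 + c * x) ^ (l - k)" if "k \<le> l" for k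
  proof -
    \<comment> \<open>At x = -1/c both sides are 1 for k = l, by the convention in
      \<open>rpow\<close>, and 0 for k < l.\<close>
    have "rpow (1 + c * x) (real l - real k) = (1 + c * x) ^ (l - k)"
      using that nonneg
      by (cases "k = l"; cases "1 + c * x = 0")
        (auto simp: rpow_def powr_realpow simp flip: of_nat_diff)
    then show ?thesis
      using c unfolding p_basis_def basis_coeff_gchoose[OF less_imp_neq[OF c]] eq
      by (simp add: power_mult_distrib)
  qed
  have p0: "p_basis c n k x = 0" if "k \<notin> {..l}" for k
    using c that unfolding p_basis_def eq by (simp add: binomial_eq_0 flip: binomial_gbinomial)
  have "S_sum n c x = (\<Sum>k\<le>l. (p_basis c n k x)\<^sup>2)"
    unfolding S_sum_def using p0 by (intro suminf_finite) auto
  also have "\<dots> = (\<Sum>k\<le>l. (basis_coeff n c k)\<^sup>2 * (x ^ (2 * k) * (1 + x * c) ^ (2 * (l - k))))"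
    by (intro sum.cong refl) (simp add: p power_mult_distrib mult_ac flip: power_mult)
  also have "\<dots> = poly ?P x"
    by (simp add: poly_sum)
  finally show "S_sum n c x = poly ?P x" .
qed

lemma S_sum_solution_on_dom_S:
  assumes hc: "c < 0 \<Longrightarrow> \<exists>l::nat. l \<ge> 1 \<and> n = - c * real l"
  shows "solution_on (S_ode n c) (dom_S c) (S_sum n c)"
proof (cases "c < 0")
  case False
  then have "dom_S c = {x \<in> dom_S c. 1 + c * x > 0}"
    by (auto simp: dom_S_def intro!: add_pos_nonneg)
  then show ?thesis using S_sum_solution_on_positive[OF hc] by blast
next
  case True
  define D where "D = {x \<in> dom_S c. 1 + c * x > 0}"
  \<comment> \<open>On this open interval derivatives within \<open>D\<close> are ordinary ones, so
    by uniqueness \<open>y'\<close> and \<open>y''\<close> are the derivatives of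
    \<open>P\<close>.\<close>
  define I where "I = {0<..<- 1 / c}"
  have ID: "I \<subseteq> D" "I \<subseteq> dom_S c" "open I"
    using True by (auto simp: I_def D_def dom_S_def field_simps)
  obtain P where P: "\<And>x. x \<in> dom_S c \<Longrightarrow> S_sum n c x = poly P x"
    using S_sum_polynomial hc True by metis
  obtain y' y'' where y: "\<And>x. x \<in> D \<Longrightarrow> (S_sum n c has_real_derivative y' x) (at x within D)"
      "\<And>x. x \<in> D \<Longrightarrow> (y' has_real_derivative y'' x) (at x within D)"
      "\<And>x. x \<in> D \<Longrightarrow> S_ode n c x (S_sum n c x) (y' x) (y'' x)"
    using S_sum_solution_on_positive[OF hc D_def] unfolding solution_on_def by blast
  have atI: "(f has_real_derivative d) (at x)"
    if "(f has_real_derivative d) (at x within D)" "x \<in> I" for f d x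
    using DERIV_subset[OF that(1) ID(1)] at_within_open[OF that(2) ID(3)] by simp
  have y'_eq: "y' x = poly (pderiv P) x" if "x \<in> I" for x
  proof (rule DERIV_unique)
    show "(S_sum n c has_real_derivative y' x) (at x)"
      using y(1) that ID by (intro atI) auto
    show "(S_sum n c has_real_derivative poly (pderiv P) x) (at x)"
      using poly_DERIV ID(3) that
      by (rule has_field_derivative_transform_within_open) (use P ID in auto)
  qed
  have y''_eq: "y'' x = poly (pderiv (pderiv P)) x" if "x \<in> I" for x
  proof (rule DERIV_unique)
    show "(y' has_real_derivative y'' x) (at x)"
      using y(2) that ID by (intro atI) auto
    show "(y' has_real_derivative poly (pderiv (pderiv P)) x) (at x)"
      using poly_DERIV ID(3) that
      by (rule has_field_derivative_transform_within_open) (simp add: y'_eq)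
  qed
  let ?E = "\<lambda>x. x * (1 + c * x) * (1 + 2 * c * x) * poly (pderiv (pderiv P)) x
      + (4 * (n + c) * x * (1 + c * x) + 1) * poly (pderiv P) x
      + 2 * n * (1 + 2 * c * x) * poly P x"
  have E_I: "?E x = 0" if "x \<in> I" for x
    using y(3)[OF subsetD[OF ID(1) that]]
    unfolding S_ode_def y'_eq[OF that] y''_eq[OF that] P[OF subsetD[OF ID(2) that]] .
  \<comment> \<open>\<open>?E\<close> is continuous and vanishes on \<open>I\<close>, hence also at
    both endpoints.\<close>
  have cont: "continuous_on (closure I) ?E" by (intro continuous_intros)
  have E: "?E x = 0" if "x \<in> closure I" for x
    by (rule continuous_constant_on_closure[OF cont E_I that])
  have "closure I = dom_S c"
    using True by (simp add: I_def dom_S_def closure_greaterThanLessThan)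
  then show ?thesis
    using P E DERIV_subset[OF poly_DERIV subset_UNIV]
    by (intro solution_onI_ext[where g = "poly P" and g' = "poly (pderiv P)"
          and g'' = "poly (pderiv (pderiv P))"]) (simp_all add: S_ode_def)
qed

section \<open>Substitution into the Heun equation\<close>

text \<open>The values -y'/c and y''/c^2 are what the chain rule yields for x \<mapsto> S(-x/c). The
  substitution turns 1 + c t and 1 + 2 c t into 1 - x and 1 - 2 x, whence the singular points 1 and
  1/2.\<close>

lemma heun_from_S_ode:
  assumes "c \<noteq> 0" "x \<notin> {0, 1 / 2, 1}" and "S_ode n c (- x / c) y y' y''"
  shows "y'' / c\<^sup>2 + (1 / x + 1 / (x - 1) + (2 * n / c) / (x - 1 / 2)) * (- y' / c)
              + (2 * n / c * x - n / c) / (x * (x - 1) * (x - 1 / 2)) * y = 0"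
proof -
  define m where "m = n / c"
  define d d' where "d = - y' / c" and "d' = y'' / c\<^sup>2"
  have n: "n = m * c" "y' = - c * d" "y'' = c\<^sup>2 * d'" "2 * n / c = 2 * m"
    using assms(1) by (auto simp: m_def d_def d'_def)
  define t where "t = - x / c"
  have x: "x = - c * t" using assms(1) by (simp add: t_def)
  have "c * (- x * (1 - x) * (1 - 2 * x) * d'
     + (4 * (m + 1) * x * (1 - x) - 1) * d + 2 * m * (1 - 2 * x) * y) = 0"
    using assms(3) unfolding S_ode_def t_def[symmetric] n(1-3) unfolding x
    by (simp add: algebra_simps power2_eq_square)
  then have E: "- x * (1 - x) * (1 - 2 * x) * d'
     + (4 * (m + 1) * x * (1 - x) - 1) * d + 2 * m * (1 - 2 * x) * y = 0"
    using assms by simp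
  \<comment> \<open>The Heun equation with denominators cleared is -1/2 times \<open>E\<close>,
    because 1 - 2 x = -2 (x - 1/2).\<close>
  have "x * (x - 1) * (x - 1 / 2) * d'
      + ((x - 1) * (x - 1 / 2) + x * (x - 1 / 2) + 2 * m * x * (x - 1)) * d + (2 * m * x - m) * y
    = - (- x * (1 - x) * (1 - 2 * x) * d'
      + (4 * (m + 1) * x * (1 - x) - 1) * d + 2 * m * (1 - 2 * x) * y) / 2"
    by (simp add: field_simps)
  also note E
  finally have *: "x * (x - 1) * (x - 1 / 2) * d'
      + ((x - 1) * (x - 1 / 2) + x * (x - 1 / 2) + 2 * m * x * (x - 1)) * d + (2 * m * x - m) * y = 0"
    by simp
  have "d' + (1 / x + 1 / (x - 1) + (2 * m) / (x - 1 / 2)) * d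
              + (2 * m * x - m) / (x * (x - 1) * (x - 1 / 2)) * y
     = (x * (x - 1) * (x - 1 / 2) * d' + ((x - 1) * (x - 1 / 2) + x * (x - 1 / 2) + 2 * m * x * (x - 1)) * d
      + (2 * m * x - m) * y) / (x * (x - 1) * (x - 1 / 2))"
    using assms(2) by (simp add: add_divide_distrib distrib_right)
  then show ?thesis
    unfolding * n(4) m_def[symmetric] d_def[symmetric] d'_def[symmetric] by simp
qed

lemma H_sum_solution_on_heun:
  assumes c: "c \<noteq> 0" and sol: "solution_on (S_ode n c) (dom_S c) (S_sum n c)"
  shows "solution_on
           (\<lambda>x y y' y''. y'' + (1 / x + 1 / (x - 1) + (2 * n / c) / (x - 1 / 2)) * y'
              + (2 * n / c * x - n / c) / (x * (x - 1) * (x - 1 / 2)) * y = 0)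
           (dom_H c - {0, 1 / 2, 1}) (H_sum n c)"
proof -
  define D where "D = dom_H c - {0, 1 / 2, 1}"
  obtain y' y'' where y: "\<And>x. x \<in> dom_S c \<Longrightarrow> (S_sum n c has_real_derivative y' x) (at x within dom_S c)"
      "\<And>x. x \<in> dom_S c \<Longrightarrow> (y' has_real_derivative y'' x) (at x within dom_S c)"
      "\<And>x. x \<in> dom_S c \<Longrightarrow> S_ode n c x (S_sum n c x) (y' x) (y'' x)"
    using sol unfolding solution_on_def by blast
  have sub: "(\<lambda>x. - x / c) ` D \<subseteq> dom_S c"
    using c by (auto simp: D_def dom_H_def dom_S_def divide_simps)
  \<comment> \<open>The inner map sends \<open>D\<close> into \<open>dom_S c\<close>, so the
    derivative within \<open>dom_S c\<close> restricts to the image of \<open>D\<close>, as the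
    chain rule within sets requires.\<close>
  have chain: "((\<lambda>x. f (- x / c)) has_real_derivative d * (- 1 / c)) (at x within D)"
    if "(f has_real_derivative d) (at (- x / c) within dom_S c)" for f d x
  proof -
    have "((\<lambda>x. - x / c) has_real_derivative - 1 / c) (at x within D)"
      using c by (auto intro!: derivative_eq_intros)
    from DERIV_image_chain[OF DERIV_subset[OF that sub] this] show ?thesis
      by (simp add: o_def)
  qed
  have mem: "- x / c \<in> dom_S c" if "x \<in> D" for x using sub that by blast
  show ?thesis
    unfolding D_def[symmetric]
  proof (rule solution_onI_ext)
    fix x assume x: "x \<in> D"
    show "H_sum n c x = S_sum n c (- x / c)" by (simp add: H_sum_def)
    show "((\<lambda>x. S_sum n c (- x / c)) has_real_derivative - y' (- x / c) / c) (at x within D)"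
      using chain[OF y(1)[OF mem[OF x]]] by simp
    show "((\<lambda>x. - y' (- x / c) / c) has_real_derivative y'' (- x / c) / c\<^sup>2) (at x within D)"
      using DERIV_cmult[OF chain[OF y(2)[OF mem[OF x]]], of "- 1 / c"]
      by (simp add: power2_eq_square)
    show "y'' (- x / c) / c\<^sup>2 + (1 / x + 1 / (x - 1) + 2 * n / c / (x - 1 / 2)) * (- y' (- x / c) / c)
        + (2 * n / c * x - n / c) / (x * (x - 1) * (x - 1 / 2)) * S_sum n c (- x / c) = 0"
      using x by (intro heun_from_S_ode c y mem) (auto simp: D_def)
  qed
qed

theorem theorem3p2:
  fixes c n :: real
  assumes "n > 0"
    and "c \<ge> 0 \<Longrightarrow> n > c"
    and "c < 0 \<Longrightarrow> \<exists>l::nat. l \<ge> 1 \<and> n = - c * real l"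
  shows "solution_on
           (\<lambda>x y y' y''. x * (1 + c * x) * (1 + 2 * c * x) * y''
              + (4 * (n + c) * x * (1 + c * x) + 1) * y'
              + 2 * n * (1 + 2 * c * x) * y = 0)
           (dom_S c) (S_sum n c) \<and>
         (c \<noteq> 0 \<longrightarrow>
         solution_on
           (\<lambda>x y y' y''. y'' + (1 / x + 1 / (x - 1) + (2 * n / c) / (x - 1 / 2)) * y'
              + (2 * n / c * x - n / c) / (x * (x - 1) * (x - 1 / 2)) * y = 0)
           (dom_H c - {0, 1 / 2, 1}) (H_sum n c) \<and>
         solution_on
           (heun_equation (1 / 2) 1 (2 * n / c) 1 1 (2 * n / c) (n / c))
           (dom_H c - {0, 1 / 2, 1}) (H_sum n c))"
proof (intro conjI impI)
  have sol: "solution_on (S_ode n c) (dom_S c) (S_sum n c)"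
    using assms(3) by (rule S_sum_solution_on_dom_S)
  then show "solution_on
           (\<lambda>x y y' y''. x * (1 + c * x) * (1 + 2 * c * x) * y''
              + (4 * (n + c) * x * (1 + c * x) + 1) * y'
              + 2 * n * (1 + 2 * c * x) * y = 0)
           (dom_S c) (S_sum n c)"
    by (simp add: solution_on_def S_ode_def)
  assume c: "c \<noteq> 0"
  show heun: "solution_on
           (\<lambda>x y y' y''. y'' + (1 / x + 1 / (x - 1) + (2 * n / c) / (x - 1 / 2)) * y'
              + (2 * n / c * x - n / c) / (x * (x - 1) * (x - 1 / 2)) * y = 0)
           (dom_H c - {0, 1 / 2, 1}) (H_sum n c)"
    using c sol by (rule H_sum_solution_on_heun)
  \<comment> \<open>Only the parameters remain to be matched: \<alpha>\<beta> = 2n/c, and \<gamma> +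
    \<delta> + \<epsilon> = 2 + 2n/c = \<alpha> + \<beta> + 1.\<close>
  then show "solution_on
           (heun_equation (1 / 2) 1 (2 * n / c) 1 1 (2 * n / c) (n / c))
           (dom_H c - {0, 1 / 2, 1}) (H_sum n c)"
    by (simp add: solution_on_def heun_equation_def)
qed

end
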